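(* Let $n\ge 2$ and let $S$ be a set of $n$ points in $\mathbb{R}^2$, no three of which lie on a line. Then the number of unordered pairs $\{p,q\}\subset S$ such that $|p-q|\in\mathbb{Q}$ and $\{p,q\}$ has rational angle is at most $n^{1+6/\sqrt{\log n}}$, where $\log$ denotes the natural logarithm.
   Context: Identify $\mathbb{R}^2$ with $\mathbb{C}$. A pair of distinct points $p,q$ has rational angle if the segment between them, viewed as the complex number $q-p=re^{\pi i\gamma}$ with $r>0$, has $\gamma\in\mathbb{Q}$; equivalently, the line through $p$ and $q$ makes an angle with the $x$-axis that is a rational multiple of $\pi$. *)

theory Defs
  imports "HOL-Analysis.Analysis"
begin

definition rational_angle :: "complex \<Rightarrow> complex \<Rightarrow> bool" where
  "rational_angle p q \<longleftrightarrow> p \<noteq> q \<and>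
     (\<exists>r::real. \<exists>\<gamma>::real. r > 0 \<and> \<gamma> \<in> \<rat> \<and>
        q - p = complex_of_real r * exp (\<i> * complex_of_real (pi * \<gamma>)))"

end

(*
Pairs with rational distance and rational angle are edges of a graph whose steps q - p are
rational multiples of roots of unity. If there were more than n * D edges with D = exp (6 * sqrt (log n)),
some subgraph would have minimum degree above D, hence at least (D - 2^k)^k walks of length k from a
fixed vertex along which no subsum of steps vanishes. All walks with a common endpoint represent the
same number as a nondegenerate rational combination of k roots of unity. Mann's theorem on minimal
vanishing sums of roots of unity leaves at most k * P directions for each step, where P <= 4^(2k) is
the product of the primes up to 2k, and since no three points are collinear the directions
determine the walk. For k about sqrt (log n) / 3 this contradicts the lower bound.

Mann's theorem follows from the invariance of rational relations among N-th roots of unity under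
z -> z^a for a coprime to N. Instead of the irreducibility of cyclotomic polynomials one only needs
primes a = q larger than a bound depending on the relation f: if f h vanishes on all N-th roots of
unity then f(x^q) h(x) is divisible by q modulo x^N - 1, and being small it is zero. The general case
follows because every residue class coprime to N contains numbers with large prime factors only.
*)

theory Submission
  imports Defs "HOL-Computational_Algebra.Computational_Algebra"
    "HOL-Computational_Algebra.Field_as_Ring" "HOL-Number_Theory.Cong"
begin

section \<open>Conjugation of roots of unity\<close>

lemma map_poly_of_int_mult:
  "map_poly (of_int :: int \<Rightarrow> 'a::{comm_ring_1,ring_char_0}) (p * q) = map_poly of_int p * map_poly of_int q"
  by (rule poly_eqI) (simp add: coeff_map_poly coeff_mult)

lemma map_poly_of_rat_mult:
  "map_poly (of_rat :: rat \<Rightarrow> 'a::field_char_0) (p * q) = map_poly of_rat p * map_poly of_rat q"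
  by (rule poly_eqI) (simp add: coeff_map_poly coeff_mult of_rat_sum of_rat_mult)

lemma map_poly_of_rat_add:
  "map_poly (of_rat :: rat \<Rightarrow> 'a::field_char_0) (p + q) = map_poly of_rat p + map_poly of_rat q"
  by (rule poly_eqI) (simp add: coeff_map_poly of_rat_add)

definition int_poly_eval :: "int poly \<Rightarrow> complex \<Rightarrow> complex" where
  "int_poly_eval p z = poly (map_poly of_int p) z"

lemma int_poly_eval_simps [simp]:
  "int_poly_eval 0 z = 0"
  "int_poly_eval (pCons a p) z = of_int a + z * int_poly_eval p z"
  "int_poly_eval (p + q) z = int_poly_eval p z + int_poly_eval q z"
  "int_poly_eval (p * q) z = int_poly_eval p z * int_poly_eval q z"
  "int_poly_eval (smult c p) z = of_int c * int_poly_eval p z"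
  "int_poly_eval (monom c n) z = of_int c * z ^ n"
proof -
  show "int_poly_eval 0 z = 0"
    by (simp add: int_poly_eval_def)
  show "int_poly_eval (pCons a p) z = of_int a + z * int_poly_eval p z"
    by (simp add: int_poly_eval_def map_poly_pCons)
  have "map_poly of_int (p + q) = (map_poly of_int p + map_poly of_int q :: complex poly)"
    by (rule poly_eqI) (simp add: coeff_map_poly)
  then show "int_poly_eval (p + q) z = int_poly_eval p z + int_poly_eval q z"
    by (simp add: int_poly_eval_def)
  show "int_poly_eval (p * q) z = int_poly_eval p z * int_poly_eval q z"
    by (simp add: int_poly_eval_def map_poly_of_int_mult)
  have "map_poly of_int (smult c p) = (smult (of_int c) (map_poly of_int p) :: complex poly)"
    by (rule poly_eqI) (simp add: coeff_map_poly)
  then show "int_poly_eval (smult c p) z = of_int c * int_poly_eval p z"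
    by (simp add: int_poly_eval_def)
  show "int_poly_eval (monom c n) z = of_int c * z ^ n"
    by (simp add: int_poly_eval_def map_poly_monom poly_monom)
qed

lemma int_poly_eval_power [simp]: "int_poly_eval (p ^ n) z = int_poly_eval p z ^ n"
  by (induction n) (simp_all add: one_pCons)

lemma int_poly_eval_sum [simp]: "int_poly_eval (\<Sum>i\<in>A. p i) z = (\<Sum>i\<in>A. int_poly_eval (p i) z)"
  by (induction A rule: infinite_finite_induct) simp_all

lemma int_poly_eval_pcompose [simp]:
  "int_poly_eval (pcompose p q) z = int_poly_eval p (int_poly_eval q z)"
  by (induction p) (simp_all add: pcompose_pCons)

lemma int_poly_eval_altdef: "int_poly_eval p z = (\<Sum>i\<le>degree p. of_int (coeff p i) * z ^ i)"
  by (simp add: int_poly_eval_def poly_altdef coeff_map_poly degree_map_poly)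

section \<open>Frobenius congruence for integer polynomials\<close>

text \<open>The middle binomial coefficients are divisible by \<open>q\<close>. The ring is general
  because the congruence serves both integers and integer polynomials.\<close>

lemma prime_dvd_power_add_diff:
  fixes a b :: "'a::comm_ring_1"
  assumes q: "prime (q::nat)"
  shows "of_nat q dvd (a + b) ^ q - (a ^ q + b ^ q)"
proof -
  have q1: "q > 1" using q prime_gt_1_nat by blast
  have "{..q} = insert 0 (insert q {1..<q})" using q1 by auto
  then have "(a + b) ^ q = b ^ q + a ^ q + (\<Sum>k\<in>{1..<q}. of_nat (q choose k) * a ^ k * b ^ (q - k))"
    using q1 by (simp add: binomial_ring)
  moreover have "of_nat q dvd (\<Sum>k\<in>{1..<q}. of_nat (q choose k) * a ^ k * b ^ (q - k))"
  proof (rule dvd_sum)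
    fix k assume "k \<in> {1..<q}"
    then have "q dvd (q choose k)" using q by (intro dvd_choose_prime) auto
    then have "(of_nat q :: 'a) dvd of_nat (q choose k)" by (auto simp: dvd_def)
    then show "of_nat q dvd of_nat (q choose k) * a ^ k * b ^ (q - k)" by (simp add: dvd_mult2)
  qed
  ultimately show ?thesis by simp
qed

text \<open>Fermat's little theorem. Natural numbers follow by induction from the previous
  congruence with second summand 1; a general integer is first reduced to its residue
  \<open>b\<close>.\<close>

lemma prime_dvd_power_diff_self:
  assumes q: "prime (q::nat)"
  shows "int q dvd a ^ q - a"
proof -
  have q0: "q > 0" using q prime_gt_0_nat by blast
  have nat: "int q dvd int n ^ q - int n" for n
  proof (induction n)
    case 0 then show ?case using q0 by (simp add: power_0_left)
  next
    case (Suc n)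
    from dvd_add[OF prime_dvd_power_add_diff[OF q, of "int n" 1] Suc]
    show ?case by (simp add: algebra_simps)
  qed
  define b where "b = a mod int q"
  have b0: "b \<ge> 0" using q0 by (simp add: b_def)
  have "[a ^ q = b ^ q] (mod int q)" unfolding b_def by (intro cong_pow) simp
  moreover have "[a = b] (mod int q)" unfolding b_def by simp
  moreover have "[b ^ q = b] (mod int q)" using nat[of "nat b"] b0 by (simp add: cong_iff_dvd_diff)
  ultimately have "[a ^ q = a] (mod int q)" using cong_trans cong_sym by blast
  then show ?thesis by (simp add: cong_iff_dvd_diff)
qed

text \<open>The binomial congruence splits off the constant term, and Fermat's little theorem
  replaces \<open>a ^ q\<close> by \<open>a\<close>.\<close>

lemma int_poly_frobenius:
  fixes f :: "int poly"
  assumes q: "prime q"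
  shows "\<exists>g. f ^ q = pcompose f (monom 1 q) + smult (int q) g"
proof (induction f)
  case 0
  then show ?case using q prime_gt_0_nat by (intro exI[of _ 0]) (auto simp: power_0_left)
next
  case (pCons a f)
  then obtain g where g: "f ^ q = pcompose f (monom 1 q) + smult (int q) g" by blast
  let ?X = "monom 1 1 :: int poly"
  from prime_dvd_power_add_diff[OF q, of "[:a:]" "?X * f"]
  obtain u where u: "([:a:] + ?X * f) ^ q - ([:a:] ^ q + (?X * f) ^ q) = of_nat q * u" by (auto simp: dvd_def)
  obtain b where b: "a ^ q - a = int q * b" using prime_dvd_power_diff_self[OF q, of a] by (auto simp: dvd_def)
  have e: "pCons a f = [:a:] + ?X * f" by (simp add: monom_altdef)
  have c: "[:a:] ^ q = [:a:] + smult (int q) [:b:]"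
    using b by (simp add: poly_const_pow)
  have m: "(?X * f) ^ q = monom 1 q * (pcompose f (monom 1 q) + smult (int q) g)"
    by (simp add: power_mult_distrib g monom_power)
  have "pCons a f ^ q = [:a:] ^ q + (?X * f) ^ q + of_nat q * u" using u unfolding e by (simp add: algebra_simps)
  also have "\<dots> = pcompose (pCons a f) (monom 1 q) + smult (int q) ([:b:] + monom 1 q * g + u)"
    unfolding c m by (simp add: pcompose_pCons algebra_simps smult_add_right of_nat_poly)
  finally show ?case by blast
qed

section \<open>Conjugation of relations among N-th roots of unity\<close>

lemma rat_poly_clear_denominators:
  fixes p :: "rat poly"
  shows "\<exists>c q. c \<noteq> (0::int) \<and> smult (of_int c) p = map_poly of_int q"
proof (induction p)
  case 0 then show ?case by (intro exI[of _ 1] exI[of _ 0]) simp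
next
  case (pCons a p)
  then obtain c q where cq: "c \<noteq> (0::int)" "smult (of_int c) p = map_poly of_int q" by blast
  obtain m n where mn: "a = of_int m / of_int n" "n > 0" by (metis quotient_of_div quotient_of_denom_pos surj_pair)
  have "smult (of_int (c * n)) (pCons a p) = map_poly of_int (pCons (c * m) (smult n q))"
    using mn by (simp add: map_poly_pCons) (simp add: map_poly_smult cq(2)[symmetric] mult.commute)
  then show ?case using cq(1) mn(2) by (intro exI[of _ "c * n"] exI[of _ "pCons (c * m) (smult n q)"]) simp
qed

text \<open>\<open>h\<close> is the cofactor of gcd(f, x^N - 1) in x^N - 1, cleared of denominators.
  Since x^N - 1 has simple roots, \<open>h\<close> does not vanish at those N-th roots of unity
  where \<open>f\<close> does.\<close>

lemma complementary_int_poly: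
  fixes f :: "int poly"
  assumes N: "N > 0"
  obtains h :: "int poly" where
    "\<And>z. z ^ N = 1 \<Longrightarrow> int_poly_eval f z * int_poly_eval h z = 0"
    "\<And>z. z ^ N = 1 \<Longrightarrow> int_poly_eval f z = 0 \<Longrightarrow> int_poly_eval h z \<noteq> 0"
proof -
  define F where "F = (map_poly of_int f :: rat poly)"
  define X where "X = (monom 1 N - 1 :: rat poly)"
  define d where "d = gcd F X"
  define C :: "rat poly \<Rightarrow> complex poly" where "C = map_poly of_rat"
  have C_mult: "C (p * q) = C p * C q" for p q by (simp add: C_def map_poly_of_rat_mult)
  have C_add: "C (p + q) = C p + C q" for p q by (simp add: C_def map_poly_of_rat_add)
  have CX: "C X = monom 1 N - 1"
    by (rule poly_eqI) (simp add: C_def X_def coeff_map_poly)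
  have CF: "poly (C F) z = int_poly_eval f z" for z
    by (simp add: C_def F_def int_poly_eval_def map_poly_map_poly o_def)
  obtain H where H: "X = d * H" unfolding d_def by (meson gcd_dvd2 dvdE)
  obtain F' where F': "F = d * F'" unfolding d_def by (meson gcd_dvd1 dvdE)
  obtain u v where uv: "u * F + v * X = d"
    unfolding d_def by (metis bezout_coefficients_fst_snd)
  obtain c h where ch: "c \<noteq> (0::int)" "smult (of_int c) H = map_poly of_int h"
    using rat_poly_clear_denominators by blast
  have h: "int_poly_eval h z = of_int c * poly (C H) z" for z
  proof -
    have "map_poly (of_int :: int \<Rightarrow> complex) h = C (map_poly of_int h)"
      by (simp add: C_def map_poly_map_poly o_def)
    also have "\<dots> = smult (of_int c) (C H)"
      unfolding ch(2)[symmetric] by (rule poly_eqI) (simp add: C_def coeff_map_poly of_rat_mult)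
    finally show ?thesis by (simp add: int_poly_eval_def)
  qed
  have X0: "poly (C X) z = 0" if "z ^ N = 1" for z using that by (simp add: CX poly_monom)
  show ?thesis
  proof (rule that)
    fix z :: complex assume z: "z ^ N = 1"
    have "F * H = F' * X" using H F' by (simp add: algebra_simps)
    then have "C F * C H = C F' * C X" by (simp flip: C_mult)
    then have "poly (C F * C H) z = poly (C F' * C X) z" by simp
    then have "poly (C F) z * poly (C H) z = 0" by (simp add: X0[OF z])
    then show "int_poly_eval f z * int_poly_eval h z = 0" by (auto simp: h CF)
    assume "int_poly_eval f z = 0"
    then have "poly (C d) z = 0" unfolding uv[symmetric] by (simp add: C_add C_mult CF X0[OF z])
    \<comment> \<open>At a zero of \<open>C d\<close> only the first summand survives, so a nonzero
      derivative of \<open>C X\<close> forces \<open>C H\<close> to be nonzero there.\<close>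
    moreover have "pderiv (C X) = pderiv (C d) * C H + C d * pderiv (C H)"
      unfolding H C_mult by (simp add: pderiv_mult algebra_simps)
    moreover have "poly (pderiv (C X)) z \<noteq> 0"
      using N z by (auto simp: CX pderiv_diff pderiv_monom poly_monom power_0_left)
    ultimately show "int_poly_eval h z \<noteq> 0" using ch(1) by (auto simp: h)
  qed
qed

text \<open>The polynomial \<open>r\<close> is the remainder of \<open>f(x\<^sup>q) h(x)\<close> modulo \<open>x\<^sup>N - 1\<close>; the point is that its
  coefficients are bounded independently of \<open>q\<close>.\<close>

lemma int_poly_wrap:
  fixes f h :: "int poly"
  assumes N: "N > 0"
  obtains r :: "int poly" where "degree r < N"
    "\<And>z. z ^ N = 1 \<Longrightarrow> int_poly_eval r z = int_poly_eval f (z ^ q) * int_poly_eval h z"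
    "\<And>n. \<bar>coeff r n\<bar> \<le> (\<Sum>i\<le>degree f. \<Sum>j\<le>degree h. \<bar>coeff f i * coeff h j\<bar>)"
proof -
  define r where "r = (\<Sum>i\<le>degree f. \<Sum>j\<le>degree h. monom (coeff f i * coeff h j) ((q * i + j) mod N))"
  show ?thesis
  proof (rule that[of r])
    have "degree r \<le> N - 1" unfolding r_def
    proof (intro degree_sum_le finite_atMost)
      fix i j
      have "(q * i + j) mod N \<le> N - 1" using mod_less_divisor[OF N, of "q * i + j"] by linarith
      then show "degree (monom (coeff f i * coeff h j) ((q * i + j) mod N)) \<le> N - 1"
        using degree_monom_le order_trans by blast
    qed
    then show "degree r < N" using N by linarith
    fix z :: complex assume z: "z ^ N = 1"
    have pm: "z ^ (n mod N) = z ^ n" for n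
    proof -
      have "z ^ n = z ^ (N * (n div N) + n mod N)" by simp
      also have "\<dots> = z ^ (n mod N)" unfolding power_add power_mult z by simp
      finally show ?thesis ..
    qed
    show "int_poly_eval r z = int_poly_eval f (z ^ q) * int_poly_eval h z"
      unfolding int_poly_eval_altdef[of f] int_poly_eval_altdef[of h] sum_product r_def int_poly_eval_sum
      by (intro sum.cong refl) (simp add: pm power_add power_mult)
  next
    fix n
    have "\<bar>coeff r n\<bar> \<le> (\<Sum>i\<le>degree f. \<Sum>j\<le>degree h. \<bar>coeff (monom (coeff f i * coeff h j) ((q * i + j) mod N)) n\<bar>)"
      unfolding r_def coeff_sum by (intro order_trans[OF sum_abs] sum_mono order_refl)
    also have "\<dots> \<le> (\<Sum>i\<le>degree f. \<Sum>j\<le>degree h. \<bar>coeff f i * coeff h j\<bar>)"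
      by (intro sum_mono) simp
    finally show "\<bar>coeff r n\<bar> \<le> (\<Sum>i\<le>degree f. \<Sum>j\<le>degree h. \<bar>coeff f i * coeff h j\<bar>)" .
  qed
qed

lemma int_poly_eq_0_if_roots_of_unity:
  fixes r :: "int poly"
  assumes N: "N > 0" and "degree r < N" and "\<And>z. z ^ N = 1 \<Longrightarrow> int_poly_eval r z = 0"
  shows "r = 0"
proof -
  have "map_poly of_int r = (0 :: complex poly)"
    by (rule poly_eqI_degree[of "{z. z ^ N = 1}"])
      (use assms in \<open>auto simp: int_poly_eval_def card_roots_unity_eq degree_map_poly\<close>)
  then show ?thesis by (simp add: map_poly_eq_0_iff)
qed

text \<open>The product of \<open>f\<close> and \<open>h\<close> gives a relation valid at every
  N-th root of unity, so coefficients can be compared. The bound depends on \<open>f\<close> and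
  \<open>h\<close> only and serves all \<open>q\<close> and \<open>z\<close>.\<close>

lemma root_of_unity_conjugate_large_prime:
  fixes f :: "int poly"
  assumes N: "N > 0"
  obtains B where "\<And>q z. prime q \<Longrightarrow> q > B \<Longrightarrow> z ^ N = 1 \<Longrightarrow> int_poly_eval f z = 0 \<Longrightarrow> int_poly_eval f (z ^ q) = 0"
proof -
  obtain h where h: "\<And>z. z ^ N = 1 \<Longrightarrow> int_poly_eval f z * int_poly_eval h z = 0"
    "\<And>z. z ^ N = 1 \<Longrightarrow> int_poly_eval f z = 0 \<Longrightarrow> int_poly_eval h z \<noteq> 0"
    using complementary_int_poly[OF N, of f] by blast
  define B where "B = (\<Sum>i\<le>degree f. \<Sum>j\<le>degree h. \<bar>coeff f i * coeff h j\<bar>)"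
  show ?thesis
  proof (rule that[of "nat B"])
    fix q z assume q: "prime q" "q > nat B" and z: "z ^ N = 1" "int_poly_eval f z = 0"
    have q0: "q > 0" using q by simp
    obtain g where g: "f ^ q = pcompose f (monom 1 q) + smult (int q) g"
      using int_poly_frobenius[OF q(1)] by blast
    obtain r where r: "degree r < N"
      "\<And>z. z ^ N = 1 \<Longrightarrow> int_poly_eval r z = int_poly_eval f (z ^ q) * int_poly_eval h z"
      "\<And>n. \<bar>coeff r n\<bar> \<le> B"
      using int_poly_wrap[OF N, of f q h] unfolding B_def by blast
    obtain s where s: "degree s < N" "\<And>z. z ^ N = 1 \<Longrightarrow> int_poly_eval s z = int_poly_eval g (z ^ 1) * int_poly_eval h z"
      by (rule int_poly_wrap[OF N, of g 1 h]) blast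
    \<comment> \<open>\<open>f(x\<^sup>q) h \<equiv> f\<^sup>q h \<equiv> 0\<close> modulo \<open>q\<close> and \<open>x\<^sup>N - 1\<close>, so all coefficients of \<open>r\<close> are
      divisible by \<open>q\<close>, yet smaller than \<open>q\<close>.\<close>
    have "r + smult (int q) s = 0"
    proof (rule int_poly_eq_0_if_roots_of_unity[OF N])
      show "degree (r + smult (int q) s) < N" using r(1) s(1) by (simp add: degree_add_less)
      fix z :: complex assume z: "z ^ N = 1"
      have "int_poly_eval (f ^ q) z * int_poly_eval h z = 0"
        using h(1)[OF z] q0 by auto
      then show "int_poly_eval (r + smult (int q) s) z = 0"
        unfolding g by (simp add: r(2)[OF z] s(2)[OF z] algebra_simps)
    qed
    then have *: "coeff r n = - int q * coeff s n" for n
    proof -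
      have "coeff (r + smult (int q) s) n = 0" by (simp add: \<open>r + smult (int q) s = 0\<close>)
      then show ?thesis by simp
    qed
    have **: "\<bar>coeff r n\<bar> < int q" for n using r(3)[of n] q(2) by linarith
    have "coeff r n = 0" for n
    proof -
      have "int q dvd coeff r n" unfolding *[of n] by simp
      then show ?thesis using dvd_imp_le_int[of "coeff r n" "int q"] **[of n] by auto
    qed
    then have "r = 0" by (simp add: poly_eq_iff)
    then show "int_poly_eval f (z ^ q) = 0" using r(2)[OF z(1)] h(2)[OF z] by simp
  qed
qed

text \<open>Composing conjugations by large primes covers every exponent whose prime factors are all
  large, and \<open>z ^ a\<close> depends only on \<open>a\<close> modulo \<open>N\<close>.\<close>

lemma root_of_unity_conjugate:
  fixes f :: "int poly"
  assumes N: "N > 0" and a: "coprime a N" and z: "z ^ N = 1" and f: "int_poly_eval f z = 0"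
  shows "int_poly_eval f (z ^ a) = 0"
proof -
  obtain B where B: "\<And>q z. prime q \<Longrightarrow> q > B \<Longrightarrow> z ^ N = 1 \<Longrightarrow> int_poly_eval f z = 0 \<Longrightarrow> int_poly_eval f (z ^ q) = 0"
    using root_of_unity_conjugate_large_prime[OF N, of f] by blast
  have gen: "int_poly_eval f (z ^ m) = 0"
    if "m > 0" "\<And>p. prime p \<Longrightarrow> p dvd m \<Longrightarrow> p > B" for m
    using that
  proof (induction m rule: prime_divisors_induct)
    case (factor p m)
    have "int_poly_eval f (z ^ m) = 0" using factor by auto
    moreover have "(z ^ m) ^ N = 1" using power_mult[of z N m] power_mult[of z m N] z by (simp add: mult.commute)
    ultimately have "int_poly_eval f ((z ^ m) ^ p) = 0" using factor by (intro B[of p "z ^ m"]) auto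
    then show ?case by (simp add: power_mult[symmetric] mult.commute)
  qed (use f in auto)
  \<comment> \<open>Shift \<open>a\<close> by a multiple of \<open>N\<close> so that all its prime factors become large.\<close>
  define t where "t = (\<Prod>p | prime p \<and> p \<le> B \<and> \<not> p dvd a. p)"
  have fin: "finite {p. prime p \<and> p \<le> B \<and> \<not> p dvd a}" by (rule finite_subset[of _ "{..B}"]) auto
  have "t > 0" unfolding t_def by (rule prod_pos) (auto dest: prime_gt_0_nat)
  have "int_poly_eval f (z ^ (a + N * t)) = 0"
  proof (rule gen)
    show "a + N * t > 0" using \<open>t > 0\<close> N by simp
    fix p assume p: "prime p" "p dvd a + N * t"
    show "p > B"
    proof (rule ccontr)
      assume pB: "\<not> p > B"
      \<comment> \<open>A small prime dividing \<open>a\<close> divides neither \<open>N\<close> nor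
        \<open>t\<close>; a small prime not dividing \<open>a\<close> divides \<open>t\<close>.
        Either way it cannot divide \<open>a + N * t\<close>.\<close>
      show False
      proof (cases "p dvd a")
        case True
        then have "p dvd N * t" using p(2) by (simp add: dvd_add_right_iff)
        moreover have "\<not> p dvd N" using a True p(1) using coprime_common_divisor[of a N p] by auto
        ultimately have "p dvd t" using p(1) prime_dvd_mult_iff by blast
        then obtain p' where "prime p'" "\<not> p' dvd a" "p dvd p'"
          unfolding t_def using prime_dvd_prod_iff[OF fin p(1)] by auto
        then show False using True p(1) primes_dvd_imp_eq by blast
      next
        case False
        then have "p dvd t" unfolding t_def using p(1) pB fin by (intro dvd_prodI) auto
        then show False using False p(2) by (simp add: dvd_add_left_iff)
      qed
    qed
  qed
  moreover have "z ^ (a + N * t) = z ^ a" by (simp add: power_add power_mult z)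
  ultimately show ?thesis by simp
qed


section \<open>Products of primes\<close>

definition primorial :: "nat \<Rightarrow> nat" where
  "primorial n = (\<Prod>p | prime p \<and> p \<le> n. p)"

lemma finite_primes_le [simp]: "finite {p::nat. prime p \<and> p \<le> n}"
  by (rule finite_subset[of _ "{..n}"]) auto

lemma primorial_pos: "primorial n > 0"
  unfolding primorial_def by (rule prod_pos) (auto dest: prime_gt_0_nat)

lemma primorial_dvd_mono: "m \<le> n \<Longrightarrow> primorial m dvd primorial n"
  unfolding primorial_def by (intro prod_dvd_prod_subset) auto

lemma dvd_primorial:
  assumes n: "n > 0" and p: "\<And>p. prime p \<Longrightarrow> p dvd n \<Longrightarrow> p \<le> r \<and> \<not> p * p dvd n"
  shows "n dvd primorial r"
proof -
  have "n = (\<Prod>p\<in>prime_factors n. p ^ multiplicity p n)"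
    using n prime_factorization_nat by blast
  also have "\<dots> = (\<Prod>p\<in>prime_factors n. p)"
  proof (rule prod.cong)
    fix q assume q: "q \<in> prime_factors n"
    then have "multiplicity q n > 0" by (simp add: prime_factors_multiplicity)
    moreover have "\<not> multiplicity q n \<ge> 2"
      using p[of q] q multiplicity_dvd'[of 2 q n] by (auto simp: power2_eq_square in_prime_factors_iff)
    ultimately have "multiplicity q n = 1" by linarith
    then show "q ^ multiplicity q n = q" by simp
  qed simp
  also have "\<dots> dvd primorial r"
    unfolding primorial_def using p by (intro prod_dvd_prod_subset) (auto simp: in_prime_factors_iff)
  finally show ?thesis .
qed

lemma prod_primes_dvd:
  fixes n :: nat
  assumes "finite A" "\<And>p. p \<in> A \<Longrightarrow> prime p \<and> p dvd n"
  shows "\<Prod>A dvd n"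
  using assms
proof (induction A)
  case (insert p A)
  have p: "prime p" using insert.prems by blast
  have "\<not> p dvd q" if "q \<in> A" for q
    using primes_dvd_imp_eq[OF p, of q] that insert.prems[of q] insert.hyps by auto
  then have "\<not> p dvd \<Prod>A"
    using prime_dvd_prod_iff[OF insert.hyps(1) p, of "\<lambda>x. x"] by auto
  then have "coprime p (\<Prod>A)" using insert by (simp add: prime_imp_coprime)
  then show ?case using insert by (simp add: divides_mult)
qed simp

section \<open>Chebyshev's upper bound for the primorial\<close>

text \<open>The two equal middle entries of row \<open>2 * m + 1\<close> add up to at most the row
  total.\<close>

lemma central_binomial_odd_le: "(2 * m + 1) choose m \<le> 4 ^ m"
proof -
  have "(\<Sum>k\<in>{m, m + 1}. (2 * m + 1) choose k) \<le> (\<Sum>k\<le>2 * m + 1. (2 * m + 1) choose k)"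
    by (intro sum_mono2) auto
  moreover have "(2 * m + 1) choose (m + 1) = (2 * m + 1) choose m"
    using binomial_symmetric[of m "2 * m + 1"] by simp
  ultimately have "2 * ((2 * m + 1) choose m) \<le> 2 ^ (2 * m + 1)"
    using choose_row_sum[of "2 * m + 1"] by simp
  then show ?thesis by (simp add: power_mult)
qed

text \<open>A prime above \<open>m + 1\<close> and at most \<open>2 * m + 1\<close> divides (2m +
  1)! but neither m! nor (m + 1)!, hence it divides the binomial coefficient.\<close>

lemma primorial_odd_le: "primorial (2 * m + 1) \<le> primorial (m + 1) * ((2 * m + 1) choose m)"
proof -
  define A where "A = {p::nat. prime p \<and> m + 1 < p \<and> p \<le> 2 * m + 1}"
  have fin: "finite A" by (rule finite_subset[of _ "{..2 * m + 1}"]) (auto simp: A_def)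
  have "{p::nat. prime p \<and> p \<le> 2 * m + 1} = {p. prime p \<and> p \<le> m + 1} \<union> A"
    by (auto simp: A_def)
  then have "primorial (2 * m + 1) = primorial (m + 1) * \<Prod>A"
    unfolding primorial_def using fin by (simp, subst prod.union_disjoint) (auto simp: A_def)
  moreover have "\<Prod>A dvd ((2 * m + 1) choose m)"
  proof (rule prod_primes_dvd[OF fin])
    fix p assume p: "p \<in> A"
    have "p dvd fact (2 * m + 1)" using p prime_dvd_fact_iff[of p "2 * m + 1"] by (auto simp: A_def simp del: fact_Suc)
    also have "fact (2 * m + 1) = fact m * fact (m + 1) * ((2 * m + 1) choose m)"
      using binomial_fact_lemma[of m "2 * m + 1"] by simp
    finally have "p dvd ((2 * m + 1) choose m)"
      using p by (auto simp: A_def prime_dvd_mult_iff prime_dvd_fact_iff simp del: fact_Suc)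
    then show "prime p \<and> p dvd ((2 * m + 1) choose m)" using p by (simp add: A_def)
  qed
  then have "\<Prod>A \<le> ((2 * m + 1) choose m)" by (rule dvd_imp_le) (simp add: zero_less_binomial_iff)
  ultimately show ?thesis by simp
qed

text \<open>Strong induction due to Erdos: an even \<open>n > 2\<close> adds no prime, and an odd
  \<open>n = 2 * m + 1\<close> reduces to \<open>m + 1\<close>.\<close>

lemma primorial_le: "primorial n \<le> 4 ^ n"
proof (induction n rule: less_induct)
  case (less n)
  consider "n = 0" | "n = 1" | "n = 2" | m where "m \<ge> 1" "n = 2 * m + 1" | "n > 2" "even n"
  proof -
    have "n = 0 \<or> n = 1 \<or> n = 2 \<or> (\<exists>m\<ge>1. n = 2 * m + 1) \<or> (n > 2 \<and> even n)"
    proof (cases "even n")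
      case True
      then have "n \<noteq> 1" by auto
      then show ?thesis using True by linarith
    next
      case False
      then obtain m where "n = 2 * m + 1" by (rule oddE)
      then show ?thesis by (cases "m = 0") auto
    qed
    then show ?thesis using that by blast
  qed
  then show ?case
  proof cases
    case 1
    then have "{p::nat. prime p \<and> p \<le> n} = {}" by auto
    then show ?thesis by (simp only: primorial_def) simp
  next
    case 2
    then have "{p::nat. prime p \<and> p \<le> n} = {}" by (auto dest: prime_gt_1_nat)
    then show ?thesis by (simp only: primorial_def) simp
  next
    case 3
    then have "{p::nat. prime p \<and> p \<le> n} = {2}" by (auto dest: prime_gt_1_nat)
    then show ?thesis unfolding primorial_def by (simp add: 3)
  next
    case (4 m)
    have "primorial n \<le> primorial (m + 1) * ((2 * m + 1) choose m)"
      unfolding 4(2) by (rule primorial_odd_le)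
    also have "\<dots> \<le> 4 ^ (m + 1) * 4 ^ m"
      using less.IH[of "m + 1"] central_binomial_odd_le[of m] 4 by (intro mult_le_mono) auto
    also have "\<dots> = 4 ^ n" unfolding 4(2) mult_2 by (simp add: power_add)
    finally show ?thesis .
  next
    case 5
    then have "\<not> prime n" using prime_odd_nat[of n] by auto
    then have "prime p \<and> p \<le> n \<longleftrightarrow> prime p \<and> p \<le> n - 1" for p by (cases "p = n") auto
    then have "primorial n = primorial (n - 1)" by (simp add: primorial_def)
    also have "\<dots> \<le> 4 ^ (n - 1)" using 5 by (intro less.IH) simp
    also have "\<dots> \<le> 4 ^ n" by (intro power_increasing) auto
    finally show ?thesis .
  qed
qed


section \<open>Mann's theorem\<close>

lemma common_denominator:
  fixes a :: "'i \<Rightarrow> complex"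
  assumes "finite I" "\<And>i. i \<in> I \<Longrightarrow> a i \<in> \<rat>"
  shows "\<exists>c::nat. c > 0 \<and> (\<forall>i\<in>I. of_nat c * a i \<in> \<int>)"
  using assms
proof (induction I)
  case (insert j I)
  then obtain c where c: "c > 0" "\<forall>i\<in>I. of_nat c * a i \<in> \<int>" by auto
  have "a j \<in> \<rat>" using insert by auto
  then obtain m n where mn: "n > 0" "a j = of_int m / of_int n" by (rule Rats_cases')
  have n: "of_nat (nat n) = (of_int n :: complex)" using mn by simp
  have "of_nat (c * nat n) * a i \<in> \<int>" if "i \<in> insert j I" for i
  proof (cases "i = j")
    case True
    then have "of_nat (c * nat n) * a i = of_int (int c * m)" using mn n by simp
    then show ?thesis by (metis Ints_of_int)
  next
    case False
    then have "of_nat c * a i \<in> \<int>" using that c by auto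
    then have "of_int n * (of_nat c * a i) \<in> \<int>" by simp
    then show ?thesis using n by (simp add: mult_ac)
  qed
  then show ?case using c mn by (intro exI[of _ "c * nat n"]) auto
qed auto

lemma common_root_of_unity_order:
  assumes "finite I" "\<And>i. i \<in> I \<Longrightarrow> \<exists>n>0. z i ^ n = (1::'a::comm_monoid_mult)"
  shows "\<exists>n>0. \<forall>i\<in>I. z i ^ n = 1"
  using assms
proof (induction I)
  case empty
  show ?case by (intro exI[of _ 1]) simp
next
  case (insert j I)
  then obtain n where n: "n > 0" "\<forall>i\<in>I. z i ^ n = 1" by blast
  obtain m where m: "m > 0" "z j ^ m = 1" using insert.prems by blast
  have "z j ^ (m * n) = 1" by (simp add: power_mult m)
  moreover have "z i ^ (m * n) = 1" if "i \<in> I" for i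
    using n(2) that by (subst mult.commute) (simp add: power_mult)
  ultimately have "\<forall>i\<in>insert j I. z i ^ (m * n) = 1" by blast
  then show ?case using n(1) m(1) by (metis nat_0_less_mult_iff)
qed

text \<open>With denominators cleared and every \<open>w i\<close> written as a power of one
  primitive n-th root of unity, the relation says that an integer polynomial vanishes at that root,
  so conjugation applies.\<close>

lemma conjugate_relation:
  fixes a w :: "'i \<Rightarrow> complex"
  assumes I: "finite I" and a: "\<And>i. i \<in> I \<Longrightarrow> a i \<in> \<rat>"
    and n: "n > 0" and w: "\<And>i. i \<in> I \<Longrightarrow> w i ^ n = 1"
    and sum: "(\<Sum>i\<in>I. a i * w i) = 0" and b: "coprime b n"
  shows "(\<Sum>i\<in>I. a i * w i ^ b) = 0"
proof -
  obtain c :: nat where c: "c > 0" "\<And>i. i \<in> I \<Longrightarrow> of_nat c * a i \<in> \<int>"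
  proof -
    have "\<exists>c::nat. c > 0 \<and> (\<forall>i\<in>I. of_nat c * a i \<in> \<int>)"
      using I a by (rule common_denominator)
    then show ?thesis using that by blast
  qed
  have "\<exists>k. of_nat c * a i = of_int k" if "i \<in> I" for i using c(2)[OF that] by (rule Ints_cases) blast
  then obtain k where k: "\<And>i. i \<in> I \<Longrightarrow> of_nat c * a i = of_int (k i)" by metis
  define \<omega> where "\<omega> = cis (2 * pi / n)"
  have "real n * (2 * pi / real n) = 2 * pi" using n by simp
  then have \<omega>: "\<omega> ^ n = 1" by (simp only: \<omega>_def Complex.DeMoivre cis_2pi)
  have "\<exists>e. w i = \<omega> ^ e" if "i \<in> I" for i
  proof -
    have "w i \<in> (\<lambda>k. cis (2 * pi * real k / real n)) ` {..<n}"
      using Complex.bij_betw_roots_unity[OF n] w[OF that] by (auto simp: bij_betw_def)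
    then obtain e where "w i = cis (2 * pi * real e / real n)" by blast
    then have "w i = \<omega> ^ e" by (simp add: \<omega>_def Complex.DeMoivre mult_ac)
    then show ?thesis ..
  qed
  then obtain e where e: "\<And>i. i \<in> I \<Longrightarrow> w i = \<omega> ^ e i" by metis
  define f where "f = (\<Sum>i\<in>I. monom (k i) (e i))"
  have f: "int_poly_eval f (\<omega> ^ d) = of_nat c * (\<Sum>i\<in>I. a i * w i ^ d)" for d
    unfolding f_def sum_distrib_left int_poly_eval_sum
    by (intro sum.cong refl) (simp add: e mult.assoc[symmetric] k power_mult[symmetric] mult.commute)
  have "int_poly_eval f \<omega> = 0" using f[of 1] sum by simp
  then have "int_poly_eval f (\<omega> ^ b) = 0" by (intro root_of_unity_conjugate[OF n b \<omega>])
  then show ?thesis using f[of b] c by simp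
qed

text \<open>These \<open>t\<close> make the exponent \<open>1 + t * m\<close> prime to
  \<open>p\<close>. If \<open>p\<close> does not divide \<open>m\<close>, a linear congruence
  excludes at most one residue; otherwise none is excluded.\<close>

lemma card_conjugating_residues:
  fixes p m :: nat
  assumes p: "prime p"
  shows "card {t. t < p \<and> \<not> p dvd 1 + t * m} \<ge> p - 1"
    and "p dvd m \<Longrightarrow> card {t. t < p \<and> \<not> p dvd 1 + t * m} = p"
proof -
  let ?T = "{t. t < p \<and> \<not> p dvd 1 + t * m}" and ?E = "{t. t < p \<and> p dvd 1 + t * m}"
  have p1: "\<not> p dvd 1" using p by (simp add: prime_nat_iff)
  show "card ?T = p" if "p dvd m"
  proof -
    have "\<not> p dvd 1 + t * m" for t using that p1 dvd_add_left_iff[of p "t * m" 1] by simp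
    then have "?T = {..<p}" by auto
    then show ?thesis by simp
  qed
  have "{..<p} = ?T \<union> ?E" by auto
  then have "card (?T \<union> ?E) = p" by (metis card_lessThan)
  then have "p = card ?T + card ?E" by (subst (asm) card_Un_disjoint) auto
  moreover have "card ?E \<le> Suc 0"
  proof (subst card_le_Suc0_iff_eq)
    have aux: "s = t" if "s \<le> t" "t < p" "p dvd 1 + s * m" "p dvd 1 + t * m" for s t
    proof -
      have "p dvd (1 + t * m) - (1 + s * m)" using that by (intro dvd_diff_nat)
      then have "p dvd (t - s) * m" by (simp add: diff_mult_distrib)
      moreover have "\<not> p dvd m"
      proof
        assume "p dvd m"
        then have "p dvd s * m" by simp
        then show False using that(3) p1 by (metis dvd_add_left_iff)
      qed
      ultimately have "p dvd t - s" using p prime_dvd_mult_iff by blast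
      then have "t - s = 0" using that(2) by (metis diff_less_mono2 dvd_imp_le less_imp_diff_less linorder_not_less not_gr_zero)
      then show ?thesis using that(1) by simp
    qed
    show "\<forall>x\<in>?E. \<forall>y\<in>?E. x = y"
    proof (intro ballI)
      fix s t assume "s \<in> ?E" "t \<in> ?E"
      then show "s = t" using aux[of s t] aux[of t s] by (cases "s \<le> t") auto
    qed
  qed auto
  ultimately show "card ?T \<ge> p - 1" by linarith
qed

section \<open>Lowering the order and Mann's theorem\<close>

text \<open>The \<open>w i ^ m\<close> are p-th roots of unity \<open>\<theta> ^ e i\<close>.
  Conjugating by \<open>1 + t * m\<close> multiplies the i-th term by
  \<open>\<theta> ^ (t * e i)\<close>; enough values of \<open>t\<close> force the sum over each
  class of equal \<open>e i\<close> to vanish. Nondegeneracy leaves a single class, that of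
  \<open>w j0 = 1\<close>.\<close>

lemma mann_reduction:
  fixes a w :: "'i \<Rightarrow> complex"
  assumes I: "finite I" and j0: "j0 \<in> I" "w j0 = 1" and a: "\<And>i. i \<in> I \<Longrightarrow> a i \<in> \<rat>"
    and p: "prime p" and m: "m > 0" "p dvd m \<or> card I < p"
    and w: "\<And>i. i \<in> I \<Longrightarrow> w i ^ (p * m) = 1"
    and sum: "(\<Sum>i\<in>I. a i * w i) = 0"
    and nondeg: "\<And>J. J \<subseteq> I \<Longrightarrow> J \<noteq> {} \<Longrightarrow> (\<Sum>i\<in>J. a i * w i) = 0 \<Longrightarrow> J = I"
    and i: "i \<in> I"
  shows "w i ^ m = 1"
proof -
  have p0: "p > 0" using p prime_gt_0_nat by blast
  define \<theta> where "\<theta> = cis (2 * pi / p)"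
  have "real p * (2 * pi / real p) = 2 * pi" using p0 by simp
  then have \<theta>p: "\<theta> ^ p = 1" by (simp only: \<theta>_def Complex.DeMoivre cis_2pi)
  have \<theta>_mod: "\<theta> ^ (k mod p) = \<theta> ^ k" for k
  proof -
    have "\<theta> ^ k = \<theta> ^ (p * (k div p) + k mod p)" by simp
    then show ?thesis by (simp only: power_add power_mult \<theta>p power_one mult_1_left)
  qed
  have \<theta>_eq: "\<theta> ^ k = cis (2 * pi * real k / real p)" for k
    by (simp add: \<theta>_def Complex.DeMoivre mult_ac)
  have \<theta>_bij: "bij_betw (\<lambda>k. \<theta> ^ k) {..<p} {z. z ^ p = 1}"
    unfolding \<theta>_eq using Complex.bij_betw_roots_unity[OF p0] .
  have "\<exists>e<p. w i ^ m = \<theta> ^ e" if "i \<in> I" for i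
  proof -
    have "(w i ^ m) ^ p = 1" using w[OF that] by (simp flip: power_mult add: mult.commute)
    then show ?thesis using \<theta>_bij by (auto simp: bij_betw_def image_iff)
  qed
  then obtain e where e: "\<And>i. i \<in> I \<Longrightarrow> e i < p" "\<And>i. i \<in> I \<Longrightarrow> w i ^ m = \<theta> ^ e i" by metis
  define T where "T = {t. t < p \<and> \<not> p dvd 1 + t * m}"
  have T: "(\<Sum>i\<in>I. a i * w i * \<theta> ^ (t * e i)) = 0" if "t \<in> T" for t
  proof -
    have "coprime (1 + t * m) p" using that p by (simp add: T_def coprime_commute prime_imp_coprime)
    moreover have "coprime (1 + t * m) m"
    proof (rule coprimeI)
      fix c assume "c dvd 1 + t * m" "c dvd m"
      then show "c dvd 1" using dvd_add_left_iff[of c "t * m" 1] by simp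
    qed
    ultimately have "coprime (1 + t * m) (p * m)" by simp
    then have "(\<Sum>i\<in>I. a i * w i ^ (1 + t * m)) = 0"
      using p0 m by (intro conjugate_relation[OF I a _ w sum]) auto
    moreover have "w i ^ (1 + t * m) = w i * \<theta> ^ (t * e i)" if "i \<in> I" for i
    proof -
      have "w i ^ (1 + t * m) = w i * (w i ^ m) ^ t" by (simp add: power_add mult.commute flip: power_mult)
      then show ?thesis using e(2)[OF that] by (simp add: mult.commute flip: power_mult)
    qed
    ultimately have "(\<Sum>i\<in>I. a i * (w i * \<theta> ^ (t * e i))) = 0"
      by (metis (no_types, lifting) sum.cong)
    then show ?thesis by (simp only: mult.assoc)
  qed
  \<comment> \<open>If \<open>p\<close> does not divide \<open>m\<close>, one residue may be missing from \<open>T\<close>; a rotation of the exponents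
    by \<open>u\<close> then moves an unused exponent to \<open>p - 1\<close> and so lowers the degree of \<open>Q\<close> below.\<close>
  obtain u D where u: "\<And>i. i \<in> I \<Longrightarrow> (e i + u) mod p < D" and D: "card T \<ge> D"
  proof (cases "p dvd m")
    case True
    show ?thesis
      by (rule that[of 0 p]) (use True p0 card_conjugating_residues(2)[OF p, of m] in \<open>auto simp: T_def\<close>)
  next
    case False
    then have "card (e ` I) < card {..<p}" using m card_image_le[OF I, of e] by simp
    then have "\<not> {..<p} \<subseteq> e ` I" using card_mono[of "e ` I" "{..<p}"] I by auto
    then obtain s where s: "s < p" "s \<notin> e ` I" by auto
    have "(e i + (p - 1 - s)) mod p < p - 1" if "i \<in> I" for i
    proof -
      have "e i < p" "e i \<noteq> s" using s e that by auto
      then consider "e i < s" | "e i > s" by linarith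
      then show ?thesis
      proof cases
        case 1
        then show ?thesis using s by simp
      next
        case 2
        then have "e i + (p - 1 - s) = (e i - s - 1) + p" using s by linarith
        then have "(e i + (p - 1 - s)) mod p = (e i - s - 1) mod p" by simp
        also have "\<dots> \<le> e i - s - 1" by simp
        also have "\<dots> < p - 1" using \<open>e i < p\<close> 2 by linarith
        finally show ?thesis .
      qed
    qed
    moreover have "card T \<ge> p - 1" unfolding T_def by (rule card_conjugating_residues(1)[OF p])
    ultimately show ?thesis by (intro that[of "p - 1 - s" "p - 1"])
  qed
  \<comment> \<open>Each coefficient of \<open>Q\<close> is a subsum of the relation. The value at
    \<open>\<theta> ^ t\<close> is the conjugated relation times \<open>\<theta> ^ (t * u)\<close>,
    so \<open>Q\<close> has more zeros than its degree would allow.\<close>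
  define Q where "Q = (\<Sum>i\<in>I. monom (a i * w i) ((e i + u) mod p))"
  have "D > 0" using u[OF j0(1)] by simp
  have "Q = 0"
  proof (rule poly_eqI_degree[of "(\<lambda>k. \<theta> ^ k) ` T"])
    have "inj_on (\<lambda>k. \<theta> ^ k) T"
      by (rule inj_on_subset[OF bij_betw_imp_inj_on[OF \<theta>_bij]]) (auto simp: T_def)
    then have card: "card ((\<lambda>k. \<theta> ^ k) ` T) = card T" by (rule card_image)
    have "degree Q \<le> D - 1" unfolding Q_def
    proof (intro degree_sum_le I)
      fix i assume "i \<in> I"
      then have "(e i + u) mod p \<le> D - 1" using u by fastforce
      then show "degree (monom (a i * w i) ((e i + u) mod p)) \<le> D - 1"
        using degree_monom_le order_trans by blast
    qed
    then show "degree Q < card ((\<lambda>k. \<theta> ^ k) ` T)" using card D \<open>D > 0\<close> by linarith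
    show "degree (0 :: complex poly) < card ((\<lambda>k. \<theta> ^ k) ` T)" using card D \<open>D > 0\<close> by simp
    fix x assume "x \<in> (\<lambda>k. \<theta> ^ k) ` T"
    then obtain t where t: "t \<in> T" "x = \<theta> ^ t" by blast
    have "(\<theta> ^ t) ^ (k mod p) = \<theta> ^ (t * k)" for k
    proof -
      have "(\<theta> ^ t) ^ (k mod p) = (\<theta> ^ (k mod p)) ^ t" by (simp add: mult.commute flip: power_mult)
      also have "\<dots> = \<theta> ^ (t * k)" by (simp add: \<theta>_mod mult.commute flip: power_mult)
      finally show ?thesis .
    qed
    then have "poly Q x = \<theta> ^ (t * u) * (\<Sum>i\<in>I. a i * w i * \<theta> ^ (t * e i))"
      unfolding Q_def poly_sum sum_distrib_left t(2)
      by (intro sum.cong refl) (simp add: poly_monom distrib_left power_add mult_ac)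
    then show "poly Q x = poly 0 x" using T[OF t(1)] by simp
  qed
  \<comment> \<open>The class of \<open>j0\<close> is a nonempty vanishing subsum, hence the whole
    relation.\<close>
  define J where "J = {i \<in> I. (e i + u) mod p = (e j0 + u) mod p}"
  have "(\<Sum>i\<in>J. a i * w i) = coeff Q ((e j0 + u) mod p)"
    using I by (auto simp: Q_def coeff_sum J_def sum.inter_filter intro: sum.cong)
  then have "J = I" using \<open>Q = 0\<close> j0 by (intro nondeg) (auto simp: J_def)
  then have "(e i + u) mod p = (e j0 + u) mod p" using i by (auto simp: J_def)
  then have "\<theta> ^ (e i + u) = \<theta> ^ (e j0 + u)" by (metis \<theta>_mod)
  then have "\<theta> ^ e i = \<theta> ^ e j0" by (simp add: power_add \<theta>_def)
  then show ?thesis using e(2)[OF i] e(2)[OF j0(1)] j0(2) by simp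
qed

text \<open>Divide by \<open>z j\<close> and take a common order \<open>n\<close> of the quotients.
  While \<open>n\<close> has a prime factor that is repeated or exceeds \<open>card I\<close>, the
  reduction removes one copy of it; the final order divides the primorial.\<close>

lemma mann:
  fixes a z :: "'i \<Rightarrow> complex"
  assumes I: "finite I" and a: "\<And>i. i \<in> I \<Longrightarrow> a i \<in> \<rat>"
    and z: "\<And>i. i \<in> I \<Longrightarrow> \<exists>n>0. z i ^ n = 1"
    and sum: "(\<Sum>i\<in>I. a i * z i) = 0"
    and nondeg: "\<And>J. J \<subseteq> I \<Longrightarrow> J \<noteq> {} \<Longrightarrow> (\<Sum>i\<in>J. a i * z i) = 0 \<Longrightarrow> J = I"
    and ij: "i \<in> I" "j \<in> I"
  shows "(z i / z j) ^ primorial (card I) = 1"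
proof -
  define w where "w = (\<lambda>i. z i / z j)"
  obtain N where N: "N > 0" "\<And>i. i \<in> I \<Longrightarrow> z i ^ N = 1"
  proof -
    have "\<exists>n>0. \<forall>i\<in>I. z i ^ n = 1" using I z by (rule common_root_of_unity_order)
    then show ?thesis using that by blast
  qed
  have zj: "z j \<noteq> 0" using N(1) N(2)[OF ij(2)] by (auto simp: power_0_left)
  have sumw: "(\<Sum>i\<in>J. a i * w i) = (\<Sum>i\<in>J. a i * z i) / z j" for J
    by (simp add: w_def sum_divide_distrib)
  have "\<forall>i\<in>I. w i ^ primorial (card I) = 1" if "n > 0" "\<forall>i\<in>I. w i ^ n = 1" for n
    using that
  proof (induction n rule: less_induct)
    case (less n)
    show ?case
    proof (cases "\<forall>p. prime p \<longrightarrow> p dvd n \<longrightarrow> p \<le> card I \<and> \<not> p * p dvd n")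
      case True
      then have "n dvd primorial (card I)" using less.prems by (intro dvd_primorial) auto
      then obtain k where "primorial (card I) = n * k" by blast
      then show ?thesis using less.prems by (simp add: power_mult)
    next
      case False
      then obtain p where p: "prime p" "p dvd n" "card I < p \<or> p * p dvd n" by auto
      then obtain m where m: "n = p * m" by blast
      have "m > 0" using m less.prems by auto
      have "p dvd m \<or> card I < p" using p m by (auto simp: prime_gt_0_nat)
      have "w i ^ m = 1" if "i \<in> I" for i
      proof (rule mann_reduction[OF I ij(2) _ _ p(1) \<open>m > 0\<close> \<open>p dvd m \<or> card I < p\<close>])
        show "w j = 1" using zj by (simp add: w_def)
        show "(\<Sum>i\<in>I. a i * w i) = 0" by (simp add: sumw sum)
        show "K = I" if "K \<subseteq> I" "K \<noteq> {}" "(\<Sum>i\<in>K. a i * w i) = 0" for K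
          using that zj by (intro nondeg) (simp_all add: sumw)
        show "w i ^ (p * m) = 1" if "i \<in> I" for i using less.prems(2) m that by blast
      qed (use a that in auto)
      moreover have "m < n" using m \<open>m > 0\<close> p(1) prime_gt_1_nat by auto
      ultimately show ?thesis using less.IH \<open>m > 0\<close> by blast
    qed
  qed
  moreover have "\<forall>i\<in>I. w i ^ N = 1" using N ij by (simp add: w_def power_divide)
  ultimately show ?thesis using N(1) ij(1) by (auto simp: w_def)
qed

text \<open>The difference of the two sums vanishes but may be degenerate, so Mann's theorem is
  applied to a smallest vanishing subsum through the i-th left term. Nondegeneracy on the left
  forces it to contain a right term.\<close>

lemma mann_two_representations:
  fixes a \<zeta> :: "'i \<Rightarrow> complex" and b \<xi> :: "'j \<Rightarrow> complex"
  assumes I: "finite I" and J: "finite J"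
    and a: "\<And>i. i \<in> I \<Longrightarrow> a i \<in> \<rat>" and b: "\<And>j. j \<in> J \<Longrightarrow> b j \<in> \<rat>"
    and \<zeta>: "\<And>i. i \<in> I \<Longrightarrow> \<exists>n>0. \<zeta> i ^ n = 1" and \<xi>: "\<And>j. j \<in> J \<Longrightarrow> \<exists>n>0. \<xi> j ^ n = 1"
    and eq: "(\<Sum>i\<in>I. a i * \<zeta> i) = (\<Sum>j\<in>J. b j * \<xi> j)"
    and nondeg: "\<And>K. K \<subseteq> I \<Longrightarrow> K \<noteq> {} \<Longrightarrow> (\<Sum>i\<in>K. a i * \<zeta> i) \<noteq> 0"
    and i: "i \<in> I"
  shows "\<exists>j\<in>J. (\<zeta> i / \<xi> j) ^ primorial (card I + card J) = 1"
proof -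
  define L where "L = Inl ` I \<union> Inr ` J"
  define c where "c = case_sum a (\<lambda>j. - b j)"
  define z where "z = case_sum \<zeta> \<xi>"
  have L: "finite L" using I J by (simp add: L_def)
  have cardL: "card L = card I + card J"
    unfolding L_def using I J by (subst card_Un_disjoint) (auto simp: card_image)
  have "(\<Sum>l\<in>L. c l * z l) = 0"
    unfolding L_def using I J
    by (subst sum.union_disjoint) (auto simp: sum.reindex c_def z_def eq sum_negf)
  then have "L \<subseteq> L \<and> Inl i \<in> L \<and> (\<Sum>l\<in>L. c l * z l) = 0" using i by (auto simp: L_def)
  from ex_has_least_nat[of "\<lambda>K. K \<subseteq> L \<and> Inl i \<in> K \<and> (\<Sum>l\<in>K. c l * z l) = 0" L card, OF this]
  obtain K where K: "K \<subseteq> L" "Inl i \<in> K" "(\<Sum>l\<in>K. c l * z l) = 0"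
    and "\<forall>K'. K' \<subseteq> L \<and> Inl i \<in> K' \<and> (\<Sum>l\<in>K'. c l * z l) = 0 \<longrightarrow> card K \<le> card K'"
    by (elim exE conjE)
  then have min: "\<And>K'. K' \<subseteq> L \<Longrightarrow> Inl i \<in> K' \<Longrightarrow> (\<Sum>l\<in>K'. c l * z l) = 0 \<Longrightarrow> card K \<le> card K'"
    by presburger
  have fK: "finite K" using K(1) L finite_subset by blast
  have Kmin: "M = K" if M: "M \<subseteq> K" "M \<noteq> {}" "(\<Sum>l\<in>M. c l * z l) = 0" for M
  proof (cases "Inl i \<in> M")
    case True
    then have "card K \<le> card M" using M K by (intro min) auto
    then show ?thesis using M(1) fK by (simp add: card_seteq)
  next
    case False
    \<comment> \<open>The complement of a vanishing subsum avoiding \<open>Inl i\<close> would be a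
      smaller vanishing subsum through \<open>Inl i\<close>.\<close>
    have "(\<Sum>l\<in>K - M. c l * z l) = 0" using M K fK by (subst sum_diff) auto
    then have "card K \<le> card (K - M)" using False K by (intro min) auto
    moreover have "card (K - M) < card K" using M fK by (intro psubset_card_mono) auto
    ultimately show ?thesis by simp
  qed
  have "\<exists>j\<in>J. Inr j \<in> K"
  proof (rule ccontr)
    assume no: "\<not> (\<exists>j\<in>J. Inr j \<in> K)"
    define K' where "K' = {i \<in> I. Inl i \<in> K}"
    have "K = Inl ` K'" using no K(1) by (auto simp: K'_def L_def)
    then have "(\<Sum>i\<in>K'. a i * \<zeta> i) = 0" using K(3) by (simp add: sum.reindex c_def z_def)
    then show False using nondeg[of K'] i K(2) by (auto simp: K'_def)
  qed
  then obtain j where j: "j \<in> J" "Inr j \<in> K" by blast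
  have "(z (Inl i) / z (Inr j)) ^ primorial (card K) = 1"
  proof (rule mann[OF fK _ _ K(3) Kmin K(2) j(2)])
    fix l assume "l \<in> K"
    then have l: "l \<in> L" using K(1) by blast
    show "c l \<in> \<rat>" using l a b by (auto simp: L_def c_def)
    show "\<exists>n>0. z l ^ n = 1" using l \<zeta> \<xi> by (auto simp: L_def z_def)
  qed
  moreover have "primorial (card K) dvd primorial (card I + card J)"
    using card_mono[OF L K(1)] cardL by (intro primorial_dvd_mono) simp
  ultimately have "(\<zeta> i / \<xi> j) ^ primorial (card I + card J) = 1"
    by (auto simp: z_def power_mult elim!: dvdE)
  then show ?thesis using j(1) by blast
qed


section \<open>Nondegenerate walks\<close>

text \<open>Deleting a vertex of degree at most \<open>D\<close> loses at most \<open>D\<close>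
  edges, so the edge hypothesis survives. It fails for the empty set, so the deletions stop
  earlier.\<close>

lemma min_degree_subset:
  fixes R :: "'a \<Rightarrow> 'a \<Rightarrow> bool" and D :: real
  assumes "finite V" and R: "symp R" and D: "D \<ge> 0"
    and "real (card {{p, q} | p q. p \<in> V \<and> q \<in> V \<and> R p q}) > D * card V"
  shows "\<exists>U\<subseteq>V. U \<noteq> {} \<and> (\<forall>u\<in>U. real (card {q \<in> U. R u q}) > D)"
  using assms(1,4)
proof (induction V rule: finite_psubset_induct)
  case (psubset V)
  let ?E = "\<lambda>V. {{p, q} | p q. p \<in> V \<and> q \<in> V \<and> R p q}"
  show ?case
  proof (cases "\<forall>u\<in>V. real (card {q \<in> V. R u q}) > D")
    case True
    have "V \<noteq> {}" using psubset.prems by auto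
    then show ?thesis using True by blast
  next
    case False
    then obtain u where u: "u \<in> V" "real (card {q \<in> V. R u q}) \<le> D" by fastforce
    have "?E (V - {u}) \<subseteq> Pow V" by auto
    then have fin: "finite (?E (V - {u}))" using psubset.hyps finite_subset by blast
    have "?E V \<subseteq> ?E (V - {u}) \<union> (\<lambda>q. {u, q}) ` {q \<in> V. R u q}"
    proof
      fix e assume "e \<in> ?E V"
      then obtain p q where e: "e = {p, q}" "p \<in> V" "q \<in> V" "R p q" by blast
      consider "p = u" | "q = u" | "p \<noteq> u" "q \<noteq> u" by blast
      then show "e \<in> ?E (V - {u}) \<union> (\<lambda>q. {u, q}) ` {q \<in> V. R u q}"
      proof cases
        case 2
        then have "R u p" using e R by (auto dest: sympD)
        then show ?thesis using e 2 by (auto simp: insert_commute)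
      qed (use e in auto)
    qed
    then have "card (?E V) \<le> card (?E (V - {u}) \<union> (\<lambda>q. {u, q}) ` {q \<in> V. R u q})"
      using fin psubset.hyps by (intro card_mono) auto
    also have "\<dots> \<le> card (?E (V - {u})) + card {q \<in> V. R u q}"
      using psubset.hyps by (intro order_trans[OF card_Un_le] add_left_mono card_image_le) simp
    finally have "real (card (?E V)) \<le> card (?E (V - {u})) + D" using u(2) by linarith
    moreover have "card V = Suc (card (V - {u}))" using u(1) psubset.hyps card.remove by metis
    ultimately have "real (card (?E (V - {u}))) > D * card (V - {u})"
      using psubset.prems by (simp add: algebra_simps)
    then have "\<exists>U\<subseteq>V - {u}. U \<noteq> {} \<and> (\<forall>u\<in>U. real (card {q \<in> U. R u q}) > D)"
      using u(1) by (intro psubset.IH) auto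
    then show ?thesis by blast
  qed
qed

section \<open>The graph of rational distances and directions\<close>

definition no_three_collinear :: "complex set \<Rightarrow> bool" where
  "no_three_collinear U \<longleftrightarrow>
     (\<forall>a\<in>U. \<forall>b\<in>U. \<forall>c\<in>U. a \<noteq> b \<longrightarrow> a \<noteq> c \<longrightarrow> b \<noteq> c \<longrightarrow> \<not> collinear {a, b, c})"

text \<open>The angle condition is encoded as the unit direction being a root of unity, the form
  that Mann's theorem takes.\<close>

definition unity_linked :: "complex \<Rightarrow> complex \<Rightarrow> bool" where
  "unity_linked p q \<longleftrightarrow> p \<noteq> q \<and> dist p q \<in> \<rat> \<and> (\<exists>n>0. sgn (q - p) ^ n = 1)"

text \<open>Reversing a step changes the sign of its direction, which doubling the exponent
  absorbs.\<close>

lemma unity_linked_sym: "symp unity_linked"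
proof (rule sympI)
  fix p q assume pq: "unity_linked p q"
  then obtain n where n: "n > 0" "sgn (q - p) ^ n = 1" by (auto simp: unity_linked_def)
  have "sgn (p - q) = - sgn (q - p)" using sgn_minus[of "q - p"] by simp
  then have "sgn (p - q) ^ (2 * n) = sgn (q - p) ^ (2 * n)" by simp
  also have "\<dots> = (sgn (q - p) ^ n) ^ 2" by (simp add: mult.commute flip: power_mult)
  finally have "sgn (p - q) ^ (2 * n) = 1" using n by simp
  then show "unity_linked q p"
    using pq n(1) by (auto simp: unity_linked_def dist_commute intro!: exI[of _ "2 * n"])
qed

text \<open>For \<open>\<gamma> = a / b\<close> the direction has argument pi a / b, so its power
  \<open>2 * b\<close> is 1.\<close>

lemma unity_linked_if_rational_angle:
  assumes "dist p q \<in> \<rat>" "rational_angle p q"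
  shows "unity_linked p q"
proof -
  from assms(2) obtain r \<gamma> :: real where r: "p \<noteq> q" "r > 0" "\<gamma> \<in> \<rat>"
    "q - p = of_real r * exp (\<i> * of_real (pi * \<gamma>))"
    unfolding rational_angle_def by blast
  obtain a b where ab: "b > 0" "\<gamma> = of_int a / of_int b" using r(3) by (rule Rats_cases')
  have "sgn (q - p) = cis (pi * \<gamma>)"
    unfolding r(4) using r(2) by (simp add: sgn_mult sgn_of_real del: of_real_mult flip: cis_conv_exp)
  then have "sgn (q - p) ^ nat (2 * b) = cis (real (nat (2 * b)) * (pi * \<gamma>))"
    by (simp only: Complex.DeMoivre)
  also have "real (nat (2 * b)) * (pi * \<gamma>) = 2 * pi * of_int a" using ab by simp
  also have "cis (2 * pi * of_int a) = 1" by (simp add: cis_multiple_2pi)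
  finally have "\<exists>n>0. sgn (q - p) ^ n = 1" using ab(1) by (intro exI[of _ "nat (2 * b)"]) auto
  then show ?thesis using assms(1) r(1) by (simp add: unity_linked_def)
qed

section \<open>Walks without vanishing subsums\<close>

text \<open>A walk is recorded as the list of its steps. The subtracted set keeps every nonempty subsum of
  the steps different from \<open>0\<close>.\<close>

fun nondegenerate_walks :: "complex set \<Rightarrow> complex \<Rightarrow> nat \<Rightarrow> complex list set" where
  "nondegenerate_walks U v 0 = {[]}"
| "nondegenerate_walks U v (Suc k) =
     (\<lambda>(xs, s). xs @ [s]) ` (SIGMA xs:nondegenerate_walks U v k.
       {s. v + sum_list xs + s \<in> U \<and> unity_linked (v + sum_list xs) (v + sum_list xs + s)}
         - (\<lambda>K. - (\<Sum>i\<in>K. xs ! i)) ` Pow {..<k})"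

lemma nondegenerate_walks_SucE:
  assumes "zs \<in> nondegenerate_walks U v (Suc k)"
  obtains xs s where "zs = xs @ [s]" "xs \<in> nondegenerate_walks U v k" "v + sum_list xs + s \<in> U"
    "unity_linked (v + sum_list xs) (v + sum_list xs + s)"
    "\<And>K. K \<subseteq> {..<k} \<Longrightarrow> s \<noteq> - (\<Sum>i\<in>K. xs ! i)"
  using assms by auto

lemma length_nondegenerate_walks: "xs \<in> nondegenerate_walks U v k \<Longrightarrow> length xs = k"
proof (induction k arbitrary: xs)
  case (Suc k)
  from Suc.prems obtain ys s where "xs = ys @ [s]" "ys \<in> nondegenerate_walks U v k"
    by (rule nondegenerate_walks_SucE)
  then show ?case using Suc.IH by simp
qed simp

lemma nondegenerate_walks_endpoint:
  assumes "v \<in> U" "xs \<in> nondegenerate_walks U v k"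
  shows "v + sum_list xs \<in> U"
proof (cases k)
  case (Suc l)
  from assms(2)[unfolded Suc] obtain ys s where "xs = ys @ [s]" "v + sum_list ys + s \<in> U"
    by (rule nondegenerate_walks_SucE)
  then show ?thesis by (simp add: add.assoc)
qed (use assms in auto)

lemma nondegenerate_walks_step:
  assumes "xs \<in> nondegenerate_walks U v k" "i < k"
  shows "norm (xs ! i) \<in> \<rat>" "\<exists>n>0. sgn (xs ! i) ^ n = 1"
proof -
  have "norm (xs ! i) \<in> \<rat> \<and> (\<exists>n>0. sgn (xs ! i) ^ n = 1)" using assms
  proof (induction k arbitrary: xs)
    case (Suc k)
    from Suc.prems(1) obtain ys s where ys: "xs = ys @ [s]" "ys \<in> nondegenerate_walks U v k"
      "unity_linked (v + sum_list ys) (v + sum_list ys + s)"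
      by (rule nondegenerate_walks_SucE)
    show ?case
    proof (cases "i < k")
      case True
      then show ?thesis using Suc.IH[OF ys(2)] ys(1) length_nondegenerate_walks[OF ys(2)]
        by (simp add: nth_append)
    next
      case False
      then have "xs ! i = s" using ys(1) length_nondegenerate_walks[OF ys(2)] Suc.prems(2)
        by (simp add: nth_append)
      then show ?thesis using ys(3) by (simp add: unity_linked_def dist_norm norm_minus_commute)
    qed
  qed simp
  then show "norm (xs ! i) \<in> \<rat>" "\<exists>n>0. sgn (xs ! i) ^ n = 1" by blast+
qed

text \<open>A subsum with the last step is nonzero because that step avoids the negated subsums of
  the earlier ones; the other subsums are covered by induction.\<close>

lemma nondegenerate_walks_subsum:
  assumes "xs \<in> nondegenerate_walks U v k" "K \<subseteq> {..<k}" "K \<noteq> {}"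
  shows "(\<Sum>i\<in>K. xs ! i) \<noteq> 0"
  using assms
proof (induction k arbitrary: xs K)
  case (Suc k)
  from Suc.prems(1) obtain ys s where ys: "xs = ys @ [s]" "ys \<in> nondegenerate_walks U v k"
    "\<And>K. K \<subseteq> {..<k} \<Longrightarrow> s \<noteq> - (\<Sum>i\<in>K. ys ! i)"
    by (rule nondegenerate_walks_SucE) blast
  have len: "length ys = k" using length_nondegenerate_walks[OF ys(2)] .
  have sub: "(\<Sum>i\<in>L. xs ! i) = (\<Sum>i\<in>L. ys ! i)" if "L \<subseteq> {..<k}" for L
    using that by (intro sum.cong refl) (auto simp: ys(1) nth_append len)
  show ?case
  proof (cases "k \<in> K")
    case False
    then have "K \<subseteq> {..<k}" using Suc.prems(2) by (auto simp: lessThan_Suc)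
    then show ?thesis using Suc.IH[OF ys(2) _ Suc.prems(3)] sub by simp
  next
    case True
    have K: "K - {k} \<subseteq> {..<k}" using Suc.prems(2) by (auto simp: lessThan_Suc)
    have "finite K" using Suc.prems(2) finite_subset by blast
    then have "(\<Sum>i\<in>K. xs ! i) = xs ! k + (\<Sum>i\<in>K - {k}. xs ! i)" using True by (rule sum.remove)
    also have "\<dots> = s + (\<Sum>i\<in>K - {k}. ys ! i)" by (simp only: sub[OF K]) (simp add: ys(1) nth_append len)
    finally show ?thesis using ys(3)[OF K] by (simp add: eq_neg_iff_add_eq_0)
  qed
qed simp

lemma finite_nondegenerate_walk_steps:
  assumes "finite U"
  shows "finite {s. p + s \<in> U \<and> unity_linked p (p + s)}"
proof (rule finite_subset)
  show "{s. p + s \<in> U \<and> unity_linked p (p + s)} \<subseteq> (\<lambda>q. q - p) ` U" by (force simp: image_iff)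
qed (use assms in simp)

lemma finite_nondegenerate_walks: "finite U \<Longrightarrow> finite (nondegenerate_walks U v k)"
  by (induction k) (auto intro!: finite_SigmaI finite_Diff finite_nondegenerate_walk_steps)

text \<open>The endpoint of a walk has at least \<open>D\<close> neighbours in \<open>U\<close>, and
  at most \<open>2 ^ k\<close> steps are forbidden, one for each set of earlier indices.\<close>

lemma card_nondegenerate_walks_Suc:
  fixes D :: real
  assumes U: "finite U" and v: "v \<in> U"
    and deg: "\<And>u. u \<in> U \<Longrightarrow> real (card {q \<in> U. unity_linked u q}) \<ge> D"
  shows "real (card (nondegenerate_walks U v (Suc k))) \<ge> (D - 2 ^ k) * card (nondegenerate_walks U v k)"
proof -
  let ?W = "nondegenerate_walks U v k"
  define A where "A = (\<lambda>xs. {s. v + sum_list xs + s \<in> U \<and> unity_linked (v + sum_list xs) (v + sum_list xs + s)})"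
  define B where "B = (\<lambda>xs::complex list. (\<lambda>K. - (\<Sum>i\<in>K. xs ! i)) ` Pow {..<k})"
  have finA: "finite (A xs)" for xs unfolding A_def by (rule finite_nondegenerate_walk_steps[OF U])
  have AB: "real (card (A xs - B xs)) \<ge> D - 2 ^ k" if xs: "xs \<in> ?W" for xs
  proof -
    define p where "p = v + sum_list xs"
    have "A xs = (\<lambda>q. q - p) ` {q \<in> U. unity_linked p q}"
      by (force simp: A_def p_def image_iff)
    then have "card (A xs) = card {q \<in> U. unity_linked p q}" by (simp add: card_image inj_on_def)
    then have "real (card (A xs)) \<ge> D"
      using deg nondegenerate_walks_endpoint[OF v xs] by (simp add: p_def)
    moreover have "card (B xs) \<le> 2 ^ k"
      unfolding B_def using card_image_le[of "Pow {..<k}"] by (simp add: card_Pow)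
    then have "real (card (B xs)) \<le> 2 ^ k" by (metis of_nat_le_iff of_nat_numeral of_nat_power)
    moreover have "card (A xs) - card (B xs) \<le> card (A xs - B xs)"
      by (rule diff_card_le_card_Diff) (simp add: B_def)
    ultimately show ?thesis by linarith
  qed
  have "nondegenerate_walks U v (Suc k) = (\<lambda>(xs, s). xs @ [s]) ` (SIGMA xs:?W. A xs - B xs)"
    by (simp add: A_def B_def)
  moreover have "inj_on (\<lambda>(xs, s). xs @ [s]) (SIGMA xs:?W. A xs - B xs)" by (auto simp: inj_on_def)
  ultimately have "card (nondegenerate_walks U v (Suc k)) = (\<Sum>xs\<in>?W. card (A xs - B xs))"
    using finA finite_nondegenerate_walks[OF U] by (simp add: card_image)
  moreover have "(D - 2 ^ k) * card ?W \<le> (\<Sum>xs\<in>?W. real (card (A xs - B xs)))"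
    using sum_mono[of ?W "\<lambda>_. D - 2 ^ k", OF AB] by (simp add: mult.commute)
  ultimately show ?thesis by simp
qed

text \<open>Replacing the loss \<open>2 ^ k\<close> at each stage by the fixed \<open>2 ^ m\<close>
  turns the product of growth factors into a power.\<close>

lemma card_nondegenerate_walks_ge:
  fixes D :: real
  assumes U: "finite U" and v: "v \<in> U"
    and deg: "\<And>u. u \<in> U \<Longrightarrow> real (card {q \<in> U. unity_linked u q}) \<ge> D"
    and D: "D \<ge> 2 ^ m" and k: "k \<le> m"
  shows "real (card (nondegenerate_walks U v k)) \<ge> (D - 2 ^ m) ^ k"
  using k
proof (induction k)
  case (Suc k)
  have "(D - 2 ^ m) ^ Suc k \<le> (D - 2 ^ k) * card (nondegenerate_walks U v k)"
    unfolding power_Suc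
  proof (intro mult_mono)
    have "(2::real) ^ k \<le> 2 ^ m" using Suc.prems by (intro power_increasing) auto
    then show "D - 2 ^ m \<le> D - 2 ^ k" "0 \<le> D - 2 ^ k" using D by linarith+
  qed (use Suc D in auto)
  also have "\<dots> \<le> card (nondegenerate_walks U v (Suc k))"
    by (rule card_nondegenerate_walks_Suc[OF U v deg])
  finally show ?case .
qed simp

section \<open>Counting walks by their directions\<close>

text \<open>Once two walks agree so far, equal directions of their next steps put the current point
  and both next points on one line, so the steps coincide.\<close>

lemma nondegenerate_walks_directions_inj:
  assumes col: "no_three_collinear U"
    and v: "v \<in> U"
  shows "inj_on (map sgn) (nondegenerate_walks U v k)"
proof (induction k)
  case (Suc k)
  show ?case
  proof (rule inj_onI)
    fix xs ys assume "xs \<in> nondegenerate_walks U v (Suc k)" "ys \<in> nondegenerate_walks U v (Suc k)"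
      and eq: "map sgn xs = map sgn ys"
    then obtain xs' s ys' t where
      x: "xs = xs' @ [s]" "xs' \<in> nondegenerate_walks U v k" "v + sum_list xs' + s \<in> U"
         "unity_linked (v + sum_list xs') (v + sum_list xs' + s)" and
      y: "ys = ys' @ [t]" "ys' \<in> nondegenerate_walks U v k" "v + sum_list ys' + t \<in> U"
         "unity_linked (v + sum_list ys') (v + sum_list ys' + t)"
      by (elim nondegenerate_walks_SucE) blast
    have "xs' = ys'" using Suc.IH x y eq by (auto dest: inj_onD)
    have st: "sgn s = sgn t" using eq x(1) y(1) by simp
    define p where "p = v + sum_list xs'"
    have p: "p \<in> U" unfolding p_def by (rule nondegenerate_walks_endpoint[OF v x(2)])
    have ps: "p + s \<in> U" "p + t \<in> U" "s \<noteq> 0" "t \<noteq> 0"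
      using x y \<open>xs' = ys'\<close> by (auto simp: p_def unity_linked_def)
    have s: "s = norm s *\<^sub>R sgn s" using ps by (simp add: sgn_div_norm)
    have t: "t = norm t *\<^sub>R sgn s" unfolding st using ps by (simp add: sgn_div_norm)
    have "collinear {p, p + s, p + t}"
      unfolding collinear_def
    proof (intro exI[of _ "sgn s"] ballI)
      fix x y assume xy: "x \<in> {p, p + s, p + t}" "y \<in> {p, p + s, p + t}"
      have "\<exists>c. x = p + c *\<^sub>R sgn s" "\<exists>c. y = p + c *\<^sub>R sgn s"
        using xy s t by (metis add.right_neutral empty_iff insert_iff scaleR_zero_left)+
      then obtain c d where "x = p + c *\<^sub>R sgn s" "y = p + d *\<^sub>R sgn s" by blast
      then have "x - y = (c - d) *\<^sub>R sgn s" by (simp add: scaleR_diff_left)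
      then show "\<exists>c. x - y = c *\<^sub>R sgn s" ..
    qed
    then have "s = t" using col p ps unfolding no_three_collinear_def by fastforce
    then show "xs = ys" using \<open>xs' = ys'\<close> x y by simp
  qed
qed simp

text \<open>Fix one walk \<open>ys\<close> ending at \<open>w\<close>. By Mann's theorem each
  direction in any such walk is a direction of \<open>ys\<close> times a root of unity of order
  dividing \<open>primorial (2 * k)\<close>, and the directions determine the walk.\<close>

lemma card_nondegenerate_walks_to_le:
  assumes col: "no_three_collinear U"
    and v: "v \<in> U"
  shows "card {xs \<in> nondegenerate_walks U v k. v + sum_list xs = w} \<le> (k * primorial (2 * k)) ^ k"
proof (cases "{xs \<in> nondegenerate_walks U v k. v + sum_list xs = w} = {}")
  case False
  let ?A = "{xs \<in> nondegenerate_walks U v k. v + sum_list xs = w}" and ?M = "primorial (2 * k)"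
  obtain ys where ys: "ys \<in> nondegenerate_walks U v k" "v + sum_list ys = w" using False by blast
  define Z where "Z = (\<Union>j<k. (\<lambda>u. sgn (ys ! j) * u) ` {u. u ^ ?M = 1})"
  have finM: "finite {u :: complex. u ^ ?M = 1}"
    using primorial_pos[of "2 * k"] by (intro finite_roots_unity) simp
  then have finZ: "finite Z" by (simp add: Z_def)
  have "card Z \<le> (\<Sum>j<k. card ((\<lambda>u. sgn (ys ! j) * u) ` {u. u ^ ?M = 1}))"
    unfolding Z_def by (rule card_UN_le) simp
  also have "\<dots> \<le> (\<Sum>j<k. ?M)"
    using card_image_le[OF finM] card_roots_unity_eq[OF primorial_pos[of "2 * k"]] by (intro sum_mono) simp
  finally have cardZ: "card Z \<le> k * ?M" by simp
  \<comment> \<open>Each step splits into its rational length, the coefficient, and its direction,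
    the root of unity.\<close>
  have sum: "(\<Sum>i<k. of_real (norm (xs ! i)) * sgn (xs ! i)) = w - v" if "xs \<in> ?A" for xs
  proof -
    have "of_real (norm z) * sgn z = z" for z :: complex by (simp add: sgn_eq)
    then have "(\<Sum>i<k. of_real (norm (xs ! i)) * sgn (xs ! i)) = sum_list xs"
      using that length_nondegenerate_walks[of xs U v k] by (auto simp: sum_list_sum_nth atLeast0LessThan)
    then show ?thesis using that by auto
  qed
  have "map sgn xs \<in> {l. set l \<subseteq> Z \<and> length l = k}" if xs: "xs \<in> ?A" for xs
  proof -
    have xsw: "xs \<in> nondegenerate_walks U v k" using xs by simp
    have len: "length xs = k" using length_nondegenerate_walks xsw by blast
    have "sgn (xs ! i) \<in> Z" if i: "i < k" for i
    proof -
      have "\<exists>j\<in>{..<k}. (sgn (xs ! i) / sgn (ys ! j)) ^ primorial (card {..<k} + card {..<k}) = 1"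
      proof (rule mann_two_representations[where a = "\<lambda>i. of_real (norm (xs ! i))" and b = "\<lambda>i. of_real (norm (ys ! i))"])
        show "(\<Sum>i<k. of_real (norm (xs ! i)) * sgn (xs ! i)) = (\<Sum>i<k. of_real (norm (ys ! i)) * sgn (ys ! i))"
          using sum[OF xs] sum[of ys] ys by simp
        show "(\<Sum>i\<in>K. of_real (norm (xs ! i)) * sgn (xs ! i)) \<noteq> 0" if "K \<subseteq> {..<k}" "K \<noteq> {}" for K
          using nondegenerate_walks_subsum[OF xsw that] by (simp add: sgn_eq)
      qed (use i nondegenerate_walks_step[OF xsw] nondegenerate_walks_step[OF ys(1)] in auto)
      then obtain j where j: "j < k" "(sgn (xs ! i) / sgn (ys ! j)) ^ ?M = 1" by (auto simp: mult_2)
      have "sgn (ys ! j) \<noteq> 0"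
        using nondegenerate_walks_subsum[OF ys(1), of "{j}"] j(1) by (simp add: sgn_zero_iff)
      then have "sgn (xs ! i) = sgn (ys ! j) * (sgn (xs ! i) / sgn (ys ! j))" by simp
      then show ?thesis unfolding Z_def using j by blast
    qed
    then show ?thesis using len by (auto simp: in_set_conv_nth)
  qed
  then have "map sgn ` ?A \<subseteq> {l. set l \<subseteq> Z \<and> length l = k}" by blast
  then have "card (map sgn ` ?A) \<le> card Z ^ k"
    using card_mono[OF finite_lists_length_eq[OF finZ, of k]] card_lists_length_eq[OF finZ, of k] by fastforce
  moreover have "card (map sgn ` ?A) = card ?A"
    by (rule card_image, rule inj_on_subset[OF nondegenerate_walks_directions_inj[OF col v]]) auto
  moreover have "card Z ^ k \<le> (k * ?M) ^ k" using cardZ by (rule power_mono) simp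
  ultimately show ?thesis by linarith
next
  case True
  then show ?thesis by (simp only: card.empty zero_le)
qed

lemma card_nondegenerate_walks_le:
  assumes col: "no_three_collinear U"
    and U: "finite U" and v: "v \<in> U"
  shows "card (nondegenerate_walks U v k) \<le> card U * (k * 4 ^ (2 * k)) ^ k"
proof -
  let ?A = "\<lambda>w. {xs \<in> nondegenerate_walks U v k. v + sum_list xs = w}"
  have "nondegenerate_walks U v k = (\<Union>w\<in>U. ?A w)"
    using nondegenerate_walks_endpoint[OF v] by blast
  then have "card (nondegenerate_walks U v k) \<le> (\<Sum>w\<in>U. card (?A w))"
    using card_UN_le[OF U, of ?A] by simp
  also have "\<dots> \<le> (\<Sum>w\<in>U. (k * 4 ^ (2 * k)) ^ k)"
    by (intro sum_mono order_trans[OF card_nondegenerate_walks_to_le[OF col v]] power_mono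
        mult_left_mono primorial_le) auto
  finally show ?thesis by simp
qed

section \<open>Choice of the walk length and the final estimate\<close>

text \<open>For \<open>k\<close> between s/3 and s/2, \<open>n = exp (s * s)\<close> is at most
  \<open>exp (3 * s) ^ k\<close>, and \<open>k * 4 ^ (2 * k)\<close> is at most
  \<open>32 ^ k\<close>, hence at most \<open>exp (2 * s)\<close>. The resulting
  \<open>exp (5 * s) ^ k\<close> stays below the lower bound for the number of walks.\<close>

lemma walk_length_choice:
  fixes n :: nat
  assumes n: "n \<ge> 2" and s: "s = sqrt (ln n)" "s > 6"
  obtains k :: nat where "2 ^ k \<le> exp (6 * s)" "real (n * (k * 4 ^ (2 * k)) ^ k) < (exp (6 * s) - 2 ^ k) ^ k"
proof -
  define k where "k = nat \<lceil>s / 3\<rceil>"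
  \<comment> \<open>Rounding up adds less than 1, and s/3 + 1 is at most s/2 because
    \<open>s > 6\<close>.\<close>
  have k: "s / 3 \<le> k" "k \<le> s / 2" using s(2) unfolding k_def by linarith+
  have "k > 0" using k(1) s(2) by (cases k) auto
  have "(2::real) \<le> exp 1" using exp_ge_add_one_self[of 1] by simp
  then have "(2::real) ^ k \<le> exp 1 ^ k" by (intro power_mono) auto
  also have "\<dots> = exp k" by (simp flip: exp_of_nat_mult)
  also have "\<dots> \<le> exp s" using k(2) s(2) by simp
  finally have pow2: "2 ^ k \<le> exp s" .
  have "exp s > 2" using exp_ge_add_one_self[of s] s(2) by linarith
  then have "exp s * exp (5 * s) > 2 * exp (5 * s)" by simp
  moreover have "exp s * exp (5 * s) = exp (6 * s)" by (simp flip: exp_add)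
  moreover have "exp s \<le> exp (5 * s)" using s(2) by simp
  ultimately have D: "exp (5 * s) < exp (6 * s) - 2 ^ k" using pow2 by linarith
  have ln: "ln n = s * s" unfolding s(1) using n by simp
  have "real n = exp (ln n)" using n by simp
  also have "\<dots> \<le> exp (3 * s) ^ k" using k(1) s(2) by (simp add: ln flip: exp_of_nat_mult)
  finally have n_le: "real n \<le> exp (3 * s) ^ k" .
  have "(5 / 2 :: real) \<le> exp 1" using exp_lower_Taylor_quadratic[of 1] by simp
  then have "(5 / 2 :: real) ^ 4 \<le> exp 1 ^ 4" by (intro power_mono) auto
  then have "(32 :: real) \<le> exp 4" by (simp add: power_divide flip: exp_of_nat_mult)
  then have "(32 :: real) ^ k \<le> exp 4 ^ k" by (intro power_mono) auto
  also have "\<dots> = exp (4 * k)" by (simp add: mult.commute flip: exp_of_nat_mult)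
  also have "\<dots> \<le> exp (2 * s)" using k(2) by simp
  finally have pow32: "32 ^ k \<le> exp (2 * s)" .
  have "real k \<le> 2 ^ k" using of_nat_less_two_power[of k, where 'a = real] by linarith
  then have "real k * 16 ^ k \<le> 2 ^ k * 16 ^ k" by simp
  also have "\<dots> = 32 ^ k" by (simp flip: power_mult_distrib)
  finally have "real k * 4 ^ (2 * k) \<le> exp (2 * s)" using pow32 by (simp add: power_mult)
  then have "real n * (real k * 4 ^ (2 * k)) ^ k \<le> exp (3 * s) ^ k * exp (2 * s) ^ k"
    using n_le by (intro mult_mono power_mono) auto
  also have "\<dots> = exp (5 * s) ^ k" by (simp flip: power_mult_distrib exp_add)
  also have "\<dots> < (exp (6 * s) - 2 ^ k) ^ k" using D \<open>k > 0\<close> by (intro power_strict_mono) auto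
  finally have "real n * (real k * 4 ^ (2 * k)) ^ k < (exp (6 * s) - 2 ^ k) ^ k" .
  then have "real (n * (k * 4 ^ (2 * k)) ^ k) < (exp (6 * s) - 2 ^ k) ^ k" by simp
  moreover have "2 ^ k \<le> exp (6 * s)" using D exp_gt_zero[of "5 * s"] by linarith
  ultimately show ?thesis by (intro that)
qed

theorem theorem2:
  fixes S :: "complex set" and n :: nat
  assumes "n \<ge> 2"
    and "finite S" and "card S = n"
    and "\<And>a b c. a \<in> S \<Longrightarrow> b \<in> S \<Longrightarrow> c \<in> S \<Longrightarrow> a \<noteq> b \<Longrightarrow> a \<noteq> c \<Longrightarrow> b \<noteq> c
           \<Longrightarrow> \<not> collinear {a, b, c}"
  shows "real (card {{p, q} | p q. p \<in> S \<and> q \<in> S \<and> p \<noteq> q \<and>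
                 dist p q \<in> \<rat> \<and> rational_angle p q})
         \<le> real n powr (1 + 6 / sqrt (ln (real n)))"
proof -
  define s where "s = sqrt (ln (real n))"
  define E where "E = {{p, q} | p q. p \<in> S \<and> q \<in> S \<and> unity_linked p q}"
  let ?E = "{{p, q} | p q. p \<in> S \<and> q \<in> S \<and> p \<noteq> q \<and> dist p q \<in> \<rat> \<and> rational_angle p q}"
  have E: "E = (\<lambda>(p, q). {p, q}) ` {(p, q) \<in> S \<times> S. unity_linked p q}" by (auto simp: E_def)
  have finE: "finite E" unfolding E using assms(2) by (intro finite_imageI) (auto intro: finite_subset[of _ "S \<times> S"])
  have "?E \<subseteq> E" unfolding E_def using unity_linked_if_rational_angle by blast
  then have EE: "card ?E \<le> card E" by (rule card_mono[OF finE])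
  have "s > 0" using assms(1) by (simp add: s_def)
  have ln: "ln n = s * s" unfolding s_def using assms(1) by simp
  have n: "real n = exp (s * s)" using assms(1) by (simp flip: ln)
  \<comment> \<open>Since \<open>ln n\<close> is the square of \<open>s\<close>, the factor
    \<open>n powr (6 / s)\<close> equals \<open>exp (6 * s)\<close>.\<close>
  have bound: "real n powr (1 + 6 / s) = n * exp (6 * s)"
    using assms(1) \<open>s > 0\<close> by (simp add: powr_def ln exp_add[symmetric] n algebra_simps)
  show ?thesis
  proof (cases "s \<le> 6")
    case True
    \<comment> \<open>For \<open>s \<le> 6\<close> one has \<open>n \<le> exp (6 * s)\<close>, so
      the trivial bound n^2 on the number of pairs suffices.\<close>
    have "card E \<le> card {(p, q) \<in> S \<times> S. unity_linked p q}"
      unfolding E using assms(2) by (intro card_image_le) (auto intro: finite_subset[of _ "S \<times> S"])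
    also have "\<dots> \<le> card (S \<times> S)" using assms(2) by (intro card_mono) auto
    finally have "real (card E) \<le> real n * real n" using assms(3)
      by (metis card_cartesian_product of_nat_le_iff of_nat_mult)
    also have "\<dots> \<le> real n * exp (6 * s)"
      using True \<open>s > 0\<close> by (intro mult_left_mono) (simp_all add: n)
    finally show ?thesis using EE bound unfolding s_def by linarith
  next
    case False
    \<comment> \<open>Otherwise a subgraph of minimum degree above \<open>exp (6 * s)\<close> has
      more nondegenerate walks of length \<open>k\<close> from \<open>v\<close> than their endpoints
      and directions allow.\<close>
    have "real (card E) \<le> exp (6 * s) * card S"
    proof (rule ccontr)
      assume "\<not> real (card E) \<le> exp (6 * s) * card S"
      then obtain U where U: "U \<subseteq> S" "U \<noteq> {}"
        "\<And>u. u \<in> U \<Longrightarrow> real (card {q \<in> U. unity_linked u q}) > exp (6 * s)"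
        using min_degree_subset[OF assms(2) unity_linked_sym, of "exp (6 * s)"] by (auto simp: E_def)
      obtain v where v: "v \<in> U" using U(2) by blast
      have finU: "finite U" using U(1) assms(2) finite_subset by blast
      have col: "no_three_collinear U"
        unfolding no_three_collinear_def using assms(4) U(1) by blast
      obtain k where k: "2 ^ k \<le> exp (6 * s)" "real (n * (k * 4 ^ (2 * k)) ^ k) < (exp (6 * s) - 2 ^ k) ^ k"
        using walk_length_choice[OF assms(1) s_def] False by auto
      have "(exp (6 * s) - 2 ^ k) ^ k \<le> card (nondegenerate_walks U v k)"
        using U(3) by (intro card_nondegenerate_walks_ge[OF finU v _ k(1)]) (auto intro: less_imp_le)
      also have "\<dots> \<le> real (card U * (k * 4 ^ (2 * k)) ^ k)"
        using card_nondegenerate_walks_le[OF col finU v] by (simp only: of_nat_le_iff)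
      also have "\<dots> \<le> real (n * (k * 4 ^ (2 * k)) ^ k)"
        using card_mono[OF assms(2) U(1)] assms(3) by (intro of_nat_mono mult_right_mono) auto
      finally show False using k(2) by simp
    qed
    then show ?thesis using EE bound assms(3) unfolding s_def by (simp add: mult.commute)
  qed
qed

end
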